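(* With $\mathcal A_N(z)=\sum_{n=N}^\infty A(n,N)z^n$ for $N\ge2$ and $\mathcal A(z_1,z_2)=\sum_{2\le N\le n}A(n,N)z_1^nz_2^N$, we have $$\mathcal A_N(z)=\mathcal A_2(z)\Bigl(\frac z{1-z}\Bigr)^{N-2},\quad N\ge2,\qquad\qquad \mathcal A(z_1,z_2)=\mathcal A_2(z_1)\,\frac{z_2^2(1-z_1)}{1-z_1(1+z_2)}.$$
   Context: For $m\ge2$, $p_1(m)$ is the smallest prime divisor of $m$. For $2\le N\le n$, $A(n,N)$ (a Cyrillic "el" in the paper) is the number of compositions $(\lambda_1,\dots,\lambda_N)\in\mathbb Z_{>0}^N$ with $\lambda_1+\dots+\lambda_N=n$ and $\min\{\lambda_1,\lambda_2\}<p_1(\lambda_1+\lambda_2)$; it is the number of partial flag varieties $F_{\boldsymbol\lambda}$ of $N$-step flags in $\mathbb C^n$ whose first semiclassical spectrum is not exceeding (one gets the same number using $(\lambda_i,\lambda_{i+1})$ for any fixed $i\le N-1$). *)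

theory Defs
  imports
    "HOL-Computational_Algebra.Primes"
    "HOL-Computational_Algebra.Formal_Power_Series"
begin

definition smallest_prime_divisor :: "nat \<Rightarrow> nat" where
  "smallest_prime_divisor m = (LEAST p. prime p \<and> p dvd m)"

definition compositions :: "nat \<Rightarrow> nat \<Rightarrow> nat list set" where
  "compositions n N = {xs. length xs = N \<and> (\<forall>x\<in>set xs. 0 < x) \<and> sum_list xs = n}"

(* A(n,N), meaningful for 2 <= N <= n only.  Lists are indexed from 0, so lambda_1 and lambda_2
   are xs ! 0 and xs ! 1. *)
definition num_non_exceeding :: "nat \<Rightarrow> nat \<Rightarrow> nat" where
  "num_non_exceeding n N =
     card {xs \<in> compositions n N. min (xs ! 0) (xs ! 1) < smallest_prime_divisor (xs ! 0 + xs ! 1)}"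

(* Generating functions are formal power series over the rationals. *)
definition gf :: "nat \<Rightarrow> rat fps" where
  "gf N = Abs_fps (\<lambda>n. if N \<le> n then of_nat (num_non_exceeding n N) else 0)"

(* Q[[z1,z2]] is represented as (Q[[z1]])[[z2]]: the coefficient of z1^n z2^N in F is fps_nth (fps_nth F N) n,
   and a series f(z1) in the first variable alone is embedded as the constant fps_const f. *)
definition gf2 :: "rat fps fps" where
  "gf2 = Abs_fps (\<lambda>N. Abs_fps (\<lambda>n. if 2 \<le> N \<and> N \<le> n then of_nat (num_non_exceeding n N) else 0))"

abbreviation z1 :: "rat fps fps" where "z1 \<equiv> fps_const fps_X"

abbreviation z2 :: "rat fps fps" where "z2 \<equiv> fps_X"

(* The library defines inverse and division for series over any coefficient type with an inverse,
   here Q[[z1]], which is not a field.  The following shows that dividing by 1 - z1 (1 + z2), whose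
   constant term 1 - z1 is a unit of Q[[z1]], is genuine division. *)
lemma gf2_denominator_unit: "(1 - z1 * (1 + z2)) * inverse (1 - z1 * (1 + z2)) = 1"
proof -
  let ?D = "1 - z1 * (1 + z2)"
  have "fps_nth ?D 0 = 1 - (fps_X :: rat fps)"
    by (simp add: fps_mult_nth)
  then have "fps_nth ?D 0 * inverse (fps_nth ?D 0) = 1"
    by (simp add: inverse_mult_eq_1')
  then show ?thesis
    by (simp add: fps_inverse_def fps_right_inverse)
qed

lemma divide_gf2_denominator: "F / (1 - z1 * (1 + z2)) = F * inverse (1 - z1 * (1 + z2))"
proof -
  let ?D = "1 - z1 * (1 + z2)"
  have "fps_nth (fps_nth ?D 0) 0 = 1"
    by (simp add: fps_mult_nth)
  then have "fps_nth ?D 0 \<noteq> 0"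
    by (metis fps_zero_nth zero_neq_one)
  then have "subdegree ?D = 0"
    by (rule subdegree_eq_0)
  then show ?thesis
    by (simp add: fps_divide_def)
qed

end

theory Submission
  imports Defs
begin

text \<open>
  The condition defining \<open>num_non_exceeding\<close> only looks at the first two parts.  A composition
  with at least three parts is therefore a composition with one part fewer, subject to the same
  condition, followed by an arbitrary positive last part.  Since \<open>z / (1 - z)\<close> is the generating
  function of a single positive part, each additional part multiplies the generating function by
  that series (\<open>gf_Suc\<close>), and the formula for \<open>gf N\<close> follows by induction from \<open>N = 2\<close>.

  For the two-variable series, the recurrence in the form \<open>gf (N + 1) (1 - z\<^sub>1) = gf N z\<^sub>1\<close> says
  that multiplying by \<open>1 - z\<^sub>1 (1 + z\<^sub>2) = (1 - z\<^sub>1) - z\<^sub>1 z\<^sub>2\<close> telescopes: every coefficient in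
  \<open>z\<^sub>2\<close> cancels except the one at \<open>z\<^sub>2\<^sup>2\<close> (\<open>gf2_times_denominator\<close>).
\<close>

definition non_exceeding :: "nat \<Rightarrow> nat \<Rightarrow> nat list set" where
  "non_exceeding n N =
     {xs \<in> compositions n N. min (xs ! 0) (xs ! 1) < smallest_prime_divisor (xs ! 0 + xs ! 1)}"

lemma num_non_exceeding_eq: "num_non_exceeding n N = card (non_exceeding n N)"
  by (simp add: num_non_exceeding_def non_exceeding_def)

lemma finite_compositions: "finite (compositions n N)"
proof (rule finite_subset)
  show "compositions n N \<subseteq> {xs. set xs \<subseteq> {0..n} \<and> length xs = N}"
    by (auto simp: compositions_def member_le_sum_list)
qed (simp add: finite_lists_length_eq)

lemma finite_non_exceeding: "finite (non_exceeding n N)"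
  by (simp add: non_exceeding_def finite_compositions)

lemma compositions_empty: "compositions n N = {}" if "n < N"
proof -
  have le: "length xs \<le> sum_list xs" if "0 \<notin> set xs" for xs :: "nat list"
    using that by (induction xs) auto
  show ?thesis
    using that by (auto simp: compositions_def dest!: le)
qed

lemma snoc_in_compositions:
  "xs @ [x] \<in> compositions n (Suc N) \<longleftrightarrow> 0 < x \<and> x \<le> n \<and> xs \<in> compositions (n - x) N"
  by (auto simp: compositions_def)

text \<open>As at least two parts precede the last one, the inequality on the first two parts is the same
  for \<open>xs @ [x]\<close> and for \<open>xs\<close>, so only the conditions for being a composition change.\<close>

lemma snoc_in_non_exceeding:
  assumes "2 \<le> N"
  shows "xs @ [x] \<in> non_exceeding n (Suc N) \<longleftrightarrow>
           0 < x \<and> x \<le> n \<and> xs \<in> non_exceeding (n - x) N"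
proof -
  have "(xs @ [x]) ! 0 = xs ! 0 \<and> (xs @ [x]) ! 1 = xs ! 1" if "length xs = N"
    using that assms by (simp add: nth_append)
  moreover have "length xs = N" if "xs \<in> compositions (n - x) N"
    using that by (simp add: compositions_def)
  ultimately show ?thesis
    unfolding non_exceeding_def mem_Collect_eq snoc_in_compositions by metis
qed

text \<open>Removing the last part and recording the sum \<open>k\<close> of the others is a bijection, because the
  removed part is then determined as \<open>n - k\<close>.\<close>

lemma num_non_exceeding_Suc:
  assumes "2 \<le> N"
  shows "num_non_exceeding n (Suc N) = (\<Sum>k<n. num_non_exceeding k N)"
proof -
  have "bij_betw (\<lambda>(k, xs). xs @ [n - k]) (SIGMA k:{..<n}. non_exceeding k N)
          (non_exceeding n (Suc N))"
  proof (rule bij_betwI')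
    fix p q
    assume "p \<in> (SIGMA k:{..<n}. non_exceeding k N)" "q \<in> (SIGMA k:{..<n}. non_exceeding k N)"
    then show "((case p of (k, xs) \<Rightarrow> xs @ [n - k]) = (case q of (k, xs) \<Rightarrow> xs @ [n - k]))
                 \<longleftrightarrow> p = q"
      by auto
  next
    fix p
    assume "p \<in> (SIGMA k:{..<n}. non_exceeding k N)"
    then show "(case p of (k, xs) \<Rightarrow> xs @ [n - k]) \<in> non_exceeding n (Suc N)"
      using assms by (auto simp: snoc_in_non_exceeding)
  next
    fix ys
    assume ys: "ys \<in> non_exceeding n (Suc N)"
    then have "length ys = Suc N"
      by (simp add: non_exceeding_def compositions_def)
    then obtain xs x where "ys = xs @ [x]"
      by (cases ys rule: rev_cases) auto
    with ys assms show "\<exists>p\<in>SIGMA k:{..<n}. non_exceeding k N.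
        ys = (case p of (k, xs) \<Rightarrow> xs @ [n - k])"
      by (intro bexI[of _ "(n - x, xs)"]) (auto simp: snoc_in_non_exceeding)
  qed
  then have "card (non_exceeding n (Suc N)) = card (SIGMA k:{..<n}. non_exceeding k N)"
    by (simp add: bij_betw_same_card)
  then show ?thesis
    by (simp add: num_non_exceeding_eq finite_non_exceeding)
qed

lemma gf_nth: "fps_nth (gf N) n = of_nat (num_non_exceeding n N)"
  by (simp add: gf_def num_non_exceeding_def compositions_empty)

lemma X_divide_one_minus_X:
  "fps_X / (1 - fps_X) = (Abs_fps (\<lambda>n. if n = 0 then 0 else 1) :: 'a :: field fps)"
proof -
  have "fps_X = Abs_fps (\<lambda>n. if n = 0 then 0 else 1) * (1 - fps_X :: 'a fps)"
    by (rule fps_ext) (auto simp: fps_X_nth algebra_simps)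
  moreover have "(1 - fps_X :: 'a fps) \<noteq> 0"
    by (rule fps_nonzeroI[of _ 0]) simp
  ultimately show ?thesis
    by (metis nonzero_mult_div_cancel_right)
qed

lemma gf_Suc: "gf (Suc N) = gf N * (fps_X / (1 - fps_X))" if "2 \<le> N"
proof (rule fps_ext)
  fix n
  have "fps_nth (gf N * (fps_X / (1 - fps_X))) n
          = (\<Sum>k=0..n. if k < n then of_nat (num_non_exceeding k N) else 0)"
    unfolding X_divide_one_minus_X fps_mult_nth
    by (intro sum.cong) (auto simp: gf_nth)
  also have "\<dots> = (\<Sum>k<n. of_nat (num_non_exceeding k N))"
    by (rule sum.mono_neutral_cong_right) auto
  finally show "fps_nth (gf (Suc N)) n = fps_nth (gf N * (fps_X / (1 - fps_X))) n"
    using that by (simp add: gf_nth num_non_exceeding_Suc)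
qed

lemma gf_eq: "gf N = gf 2 * (fps_X / (1 - fps_X)) ^ (N - 2)" if "2 \<le> N"
  using that
proof (induction N rule: nat_induct_at_least)
  case (Suc N)
  then have "Suc N - 2 = Suc (N - 2)"
    by simp
  with Suc show ?case
    by (simp only: gf_Suc power_Suc2 mult.assoc)
qed simp

lemma gf_Suc_times_one_minus_X: "gf (Suc N) * (1 - fps_X) = gf N * fps_X" if "2 \<le> N"
proof -
  have "(fps_X / (1 - fps_X)) * (1 - fps_X) = (fps_X :: rat fps)"
    by (simp add: fps_divide_unit mult.assoc inverse_mult_eq_1)
  with that show ?thesis
    by (simp add: gf_Suc mult.assoc)
qed

lemma gf2_nth: "fps_nth gf2 N = (if 2 \<le> N then gf N else 0)"
  by (rule fps_ext) (simp add: gf2_def gf_def)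

text \<open>At \<open>z\<^sub>2\<^sup>N\<close> the left-hand side has the coefficient \<open>gf N (1 - z\<^sub>1) - z\<^sub>1 gf (N - 1)\<close> for \<open>N > 2\<close>,
  which vanishes by the recurrence; at \<open>N = 2\<close> the second term is absent because \<open>gf2\<close> starts at
  \<open>z\<^sub>2\<^sup>2\<close>, so \<open>gf 2 (1 - z\<^sub>1)\<close> remains.\<close>

lemma gf2_times_denominator:
  "gf2 * (1 - z1 * (1 + z2)) = fps_const (gf 2) * (z2 ^ 2 * (1 - z1))"
proof (rule fps_ext)
  fix N
  have "gf2 * (1 - z1 * (1 + z2)) = gf2 * fps_const (1 - fps_X) - fps_const fps_X * (gf2 * z2)"
    by (simp add: algebra_simps flip: fps_const_sub)
  then have lhs: "fps_nth (gf2 * (1 - z1 * (1 + z2))) N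
      = fps_nth gf2 N * (1 - fps_X) - fps_X * (if N = 0 then 0 else fps_nth gf2 (N - 1))"
    by simp
  have "fps_const (gf 2) * (z2 ^ 2 * (1 - z1)) = fps_const (gf 2 * (1 - fps_X)) * z2 ^ 2"
    by (simp add: algebra_simps flip: fps_const_sub fps_const_mult)
  then have "fps_nth (fps_const (gf 2) * (z2 ^ 2 * (1 - z1))) N
      = fps_nth (fps_const (gf 2 * (1 - fps_X)) * z2 ^ 2) N"
    by (rule arg_cong)
  then have rhs: "fps_nth (fps_const (gf 2) * (z2 ^ 2 * (1 - z1))) N
      = (if N = 2 then gf 2 * (1 - fps_X) else 0)"
    by (simp only: fps_mult_left_const_nth fps_X_power_nth) simp
  consider "N < 2" | "N = 2" | M where "N = Suc M" "2 \<le> M"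
    by (cases N) fastforce+
  then show "fps_nth (gf2 * (1 - z1 * (1 + z2))) N
      = fps_nth (fps_const (gf 2) * (z2 ^ 2 * (1 - z1))) N"
    unfolding lhs rhs
    by cases (auto simp: gf2_nth gf_Suc_times_one_minus_X mult.commute)
qed

theorem theorem4p3:
  shows "(\<forall>N\<ge>2. gf N = gf 2 * (fps_X / (1 - fps_X)) ^ (N - 2)) \<and>
         gf2 = fps_const (gf 2) * (z2 ^ 2 * (1 - z1) / (1 - z1 * (1 + z2)))"
proof
  show "\<forall>N\<ge>2. gf N = gf 2 * (fps_X / (1 - fps_X)) ^ (N - 2)"
    using gf_eq by blast
next
  let ?D = "1 - z1 * (1 + z2)"
  have "gf2 = gf2 * (?D * inverse ?D)"
    by (simp only: gf2_denominator_unit mult_1_right)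
  also have "\<dots> = fps_const (gf 2) * (z2 ^ 2 * (1 - z1)) * inverse ?D"
    by (simp only: gf2_times_denominator flip: mult.assoc)
  also have "\<dots> = fps_const (gf 2) * (z2 ^ 2 * (1 - z1) / ?D)"
    by (simp only: divide_gf2_denominator mult.assoc)
  finally show "gf2 = fps_const (gf 2) * (z2 ^ 2 * (1 - z1) / ?D)" .
qed

end
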